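(* Let $s,n,d$ be positive integers and let $G$ be a finite abelian group with $b\ge2$ elements. Let $P\subset G^{s\times n}$ be a subgroup with $|P|\le b^d$. Let $C$ be an arbitrary positive real number greater than $1/2$. If $$\frac ds\ \ge\ \frac{\sqrt{C+1/16}+3/4}{C-1/2},$$ then $$\mathrm{WF}^n(P)\ge b^{-Cd^2/s}.$$
   Context: $G^\vee=\mathrm{Hom}(G,T)$, with $T=\{z\in\mathbb{C}:|z|=1\}$, is the character group of $G$, written additively, and $h\bullet g:=h(g)$. The character group of $G^{s\times n}$ ($s\times n$ matrices over $G$) is identified with $(G^\vee)^{s\times n}$ via $A\bullet B=\prod_{i,j}a_{i,j}\bullet b_{i,j}$. $P^\perp=\{A\in(G^\vee)^{s\times n}:A\bullet B=1\text{ for all }B\in P\}$. The Dick weight of $A=(a_{i,j})\in(G^\vee)^{s\times n}$ is $\mu(A)=\sum_{i,j}j\,\delta(a_{i,j})$ with $\delta(0)=0$ and $\delta(h)=1$ for $h\neq0$. The Walsh figure of merit (WAFOM) is $\mathrm{WF}^n(P)=\mathrm{WF}(P)=\sum_{A\in P^\perp\setminus\{O\}}b^{-\mu(A)}$, where $O$ is the zero matrix.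
   Formalization: P is required to be a proper subgroup of G^{s×n}: for P = G^{s×n} the sum WF(P) is empty, hence 0, and the inequality fails (e.g. s=n=1, d=4, C=1, P=G of order 2); only this single case is excluded. *)

theory Defs
  imports Complex_Main "HOL-Algebra.Product_Groups" "HOL-Algebra.Multiplicative_Group"
begin

text \<open>
  Groups are those of HOL-Algebra, hence written multiplicatively; the neutral element of a
  group plays the role of the 0 of an additively written abelian group.
\<close>

definition circle_group :: "complex monoid" where
  "circle_group = \<lparr>carrier = {z. cmod z = 1}, monoid.mult = (*), one = 1\<rparr>"

text \<open>
  Elements of \<open>hom G H\<close> are unconstrained outside \<open>carrier G\<close>; the intersection with
  \<open>extensional (carrier G)\<close> makes each character occur exactly once.
\<close>

definition character_group :: "('a, 'm) monoid_scheme \<Rightarrow> ('a \<Rightarrow> complex) monoid" where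
  "character_group G =
     \<lparr>carrier = hom G circle_group \<inter> extensional (carrier G),
      monoid.mult = (\<lambda>\<chi> \<psi>. \<lambda>g\<in>carrier G. \<chi> g \<otimes>\<^bsub>circle_group\<^esub> \<psi> g),
      one = (\<lambda>g\<in>carrier G. \<one>\<^bsub>circle_group\<^esub>)\<rparr>"

text \<open>The group of \<open>s \<times> n\<close> matrices over \<open>G\<close>, with rows and columns numbered from 1.\<close>

definition matrix_group ::
    "nat \<Rightarrow> nat \<Rightarrow> ('a, 'm) monoid_scheme \<Rightarrow> (nat \<times> nat \<Rightarrow> 'a) monoid" where
  "matrix_group s n G = product_group ({1..s} \<times> {1..n}) (\<lambda>_. G)"

definition matrix_pairing ::
    "nat \<Rightarrow> nat \<Rightarrow> (nat \<times> nat \<Rightarrow> 'a \<Rightarrow> complex) \<Rightarrow> (nat \<times> nat \<Rightarrow> 'a) \<Rightarrow> complex" where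
  "matrix_pairing s n A B = (\<Prod>i=1..s. \<Prod>j=1..n. A (i, j) (B (i, j)))"

definition annihilator ::
    "nat \<Rightarrow> nat \<Rightarrow> ('a, 'm) monoid_scheme \<Rightarrow> (nat \<times> nat \<Rightarrow> 'a) set
       \<Rightarrow> (nat \<times> nat \<Rightarrow> 'a \<Rightarrow> complex) set" where
  "annihilator s n G P =
     {A \<in> carrier (matrix_group s n (character_group G)).
        \<forall>B\<in>P. matrix_pairing s n A B = 1}"

definition dick_weight ::
    "nat \<Rightarrow> nat \<Rightarrow> ('a, 'm) monoid_scheme \<Rightarrow> (nat \<times> nat \<Rightarrow> 'a \<Rightarrow> complex) \<Rightarrow> nat" where
  "dick_weight s n G A =
     (\<Sum>i=1..s. \<Sum>j=1..n. j * (if A (i, j) = \<one>\<^bsub>character_group G\<^esub> then 0 else 1))"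

definition WAFOM ::
    "nat \<Rightarrow> nat \<Rightarrow> ('a, 'm) monoid_scheme \<Rightarrow> (nat \<times> nat \<Rightarrow> 'a) set \<Rightarrow> real" where
  "WAFOM s n G P =
     (\<Sum>A \<in> annihilator s n G P - {\<one>\<^bsub>matrix_group s n (character_group G)\<^esub>}.
        real (order G) powr - real (dick_weight s n G A))"

lemma comm_group_circle_group: "comm_group circle_group"
proof (rule comm_groupI)
  fix x assume "x \<in> carrier circle_group"
  then show "\<exists>y\<in>carrier circle_group. y \<otimes>\<^bsub>circle_group\<^esub> x = \<one>\<^bsub>circle_group\<^esub>"
    by (intro bexI[of _ "inverse x"]) (auto simp: circle_group_def norm_inverse intro!: left_inverse)
qed (auto simp: circle_group_def norm_mult)

text \<open>The sum defining \<^const>\<open>WAFOM\<close> is finite for finite \<open>G\<close>.\<close>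

lemma finite_carrier_character_group:
  assumes "group G" "finite (carrier G)"
  shows "finite (carrier (character_group G))"
proof -
  interpret G: group G by fact
  interpret T: comm_group circle_group by (rule comm_group_circle_group)
  have ord: "order G > 0"
    using assms(2) G.one_closed by (auto simp: order_def card_gt_0_iff)
  have pow: "x [^]\<^bsub>circle_group\<^esub> (k::nat) = x ^ k" for x k
    by (induction k) (simp_all add: circle_group_def nat_pow_def)
  have "carrier (character_group G) \<subseteq> carrier G \<rightarrow>\<^sub>E {z::complex. z ^ order G = 1}"
  proof
    fix \<chi> assume \<chi>: "\<chi> \<in> carrier (character_group G)"
    then have hom: "\<chi> \<in> hom G circle_group" and ext: "\<chi> \<in> extensional (carrier G)"
      by (auto simp: character_group_def)
    interpret h: group_hom G circle_group \<chi>
      by unfold_locales (rule hom)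
    have "\<chi> g ^ order G = 1" if g: "g \<in> carrier G" for g
    proof -
      have "\<chi> g [^]\<^bsub>circle_group\<^esub> order G = \<chi> (g [^]\<^bsub>G\<^esub> order G)"
        using g by (simp add: h.hom_nat_pow)
      also have "\<dots> = \<one>\<^bsub>circle_group\<^esub>"
        using g by (simp add: G.pow_order_eq_1)
      finally show ?thesis by (simp add: pow) (simp add: circle_group_def)
    qed
    with ext show "\<chi> \<in> carrier G \<rightarrow>\<^sub>E {z. z ^ order G = 1}"
      by (auto simp: PiE_def)
  qed
  moreover have "finite (carrier G \<rightarrow>\<^sub>E {z::complex. z ^ order G = 1})"
    using ord assms(2) by (intro finite_PiE) (auto intro: finite_roots_unity)
  ultimately show ?thesis by (rule finite_subset)
qed

lemma finite_annihilator:
  assumes "group G" "finite (carrier G)"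
  shows "finite (annihilator s n G P)"
proof -
  have "finite (carrier (matrix_group s n (character_group G)))"
    using finite_carrier_character_group[OF assms]
    by (simp add: matrix_group_def finite_PiE)
  then show ?thesis by (rule finite_subset[rotated]) (auto simp: annihilator_def)
qed

end

theory Submission
  imports Defs
begin

text \<open>
  The bound already holds for a single term of the sum: it suffices to find one nonzero
  \<open>A \<in> P\<^sup>\<bottom>\<close> with \<open>\<mu>(A) \<le> C d\<^sup>2 / s\<close>.
  The weight of column \<open>j\<close> is \<open>j\<close>, so light matrices are those supported on the first few columns.

  Let \<open>m = min n (\<lfloor>d/s\<rfloor> + 1)\<close>. Then \<open>|P| < b\<^sup>s\<^sup>m\<close>: if \<open>m = n\<close> this says that \<open>P\<close> is a proper
  subgroup, and otherwise \<open>s m > d\<close>. Hence the restriction of \<open>P\<close> to the first \<open>m\<close> columns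
  misses some \<open>s \<times> m\<close> matrix, so the group \<open>H\<close> of all matrices that agree with an element of
  \<open>P\<close> on these columns is still proper. A proper subgroup of a finite abelian group is
  annihilated by a nontrivial character (\<open>exists_character_trivial_on_subgroup\<close>), and a
  character of \<open>G\<^bsup>s\<times>n\<^esup>\<close> is a matrix of characters of \<open>G\<close>
  (\<open>character_product_group_eq_prod\<close>). Since \<open>H\<close> contains \<open>P\<close> and every matrix supported
  outside the first \<open>m\<close> columns, the resulting \<open>A\<close> lies in \<open>P\<^sup>\<bottom>\<close> and is supported on the first
  \<open>m\<close> columns. So \<open>\<mu>(A) \<le> s m (m + 1) / 2\<close>.

  With \<open>x = d/s\<close> and \<open>m \<le> x + 1\<close> this is at most \<open>s (x + 1) (x + 2) / 2\<close>. The hypothesis on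
  \<open>d/s\<close> is \<open>x\<close> being at least the larger root of \<open>(C - 1/2) x\<^sup>2 - 3/2 x - 1\<close>, and that
  polynomial being nonnegative means exactly \<open>(x + 1) (x + 2) / 2 \<le> C x\<^sup>2\<close>.
\<close>

section \<open>Characters of finite abelian groups\<close>

lemma cis_root_of_unity_eq_iff:
  assumes "p > 0"
  shows "cis (2 * pi * (of_int k / real p)) = cis (2 * pi * (of_int l / real p)) \<longleftrightarrow> int p dvd k - l"
proof -
  have "cis (2 * pi * (of_int k / real p)) = cis (2 * pi * (of_int l / real p)) \<longleftrightarrow>
        cis (2 * pi * (of_int k / real p)) / cis (2 * pi * (of_int l / real p)) = 1"
    by simp
  also have "\<dots> \<longleftrightarrow> cis (2 * pi * (of_int (k - l) / real p)) = 1"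
    by (simp add: cis_divide algebra_simps diff_divide_distrib)
  also have "\<dots> \<longleftrightarrow> int p dvd k - l"
  proof
    assume "cis (2 * pi * (of_int (k - l) / real p)) = 1"
    then have "cos (2 * pi * (of_int (k - l) / real p)) = 1"
      by (simp add: complex_eq_iff)
    then obtain m :: int where "2 * pi * (of_int (k - l) / real p) = of_int m * 2 * pi"
      by (auto simp: cos_one_2pi_int)
    then have "2 * pi * (of_int (k - l) / real p) = 2 * pi * of_int m"
      by (simp only: mult_ac)
    then have "of_int (k - l) / real p = of_int m"
      by (subst (asm) mult_cancel_left) simp
    then have "real_of_int (k - l) = of_int (int p * m)"
      using assms by (simp add: field_simps)
    then show "int p dvd k - l"
      by (metis dvd_triv_left of_int_eq_iff)
  next
    assume "int p dvd k - l"
    then obtain m where "k - l = int p * m" ..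
    then have "real_of_int (k - l) / real p = of_int m"
      using assms by simp
    then show "cis (2 * pi * (of_int (k - l) / real p)) = 1"
      by simp
  qed
  finally show ?thesis .
qed

text \<open>
  The choice of the exponent in \<open>x = g\<^sup>k\<close> is harmless: it is unique modulo the order of \<open>g\<close>,
  which is the period of the root of unity.
\<close>

lemma (in group) cyclic_group_character:
  assumes g: "g \<in> carrier G" and gen: "carrier G = range (\<lambda>k::int. g [^] k)" and p: "ord g > 0"
  obtains \<chi> where "\<chi> \<in> hom G circle_group" "\<chi> g = cis (2 * pi / real (ord g))"
proof -
  define \<zeta> where "\<zeta> k = cis (2 * pi * (of_int k / real (ord g)))" for k :: int
  define \<chi> where "\<chi> x = \<zeta> (SOME k::int. x = g [^] k)" for x
  have \<chi>_pow: "\<chi> (g [^] k) = \<zeta> k" for k :: int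
  proof -
    have "g [^] k = g [^] (SOME l::int. g [^] k = g [^] l)"
      by (rule someI[of "\<lambda>l. g [^] k = g [^] l"]) simp
    then have "int (ord g) dvd (SOME l::int. g [^] k = g [^] l) - k"
      using g by (simp only: int_pow_eq)
    then show ?thesis
      unfolding \<chi>_def \<zeta>_def using p by (simp only: cis_root_of_unity_eq_iff)
  qed
  have "\<chi> \<in> hom G circle_group"
  proof (rule homI)
    fix x y assume "x \<in> carrier G" "y \<in> carrier G"
    then obtain k l :: int where "x = g [^] k" "y = g [^] l"
      using gen by auto
    then have "\<chi> (x \<otimes> y) = \<zeta> (k + l)" "\<chi> x = \<zeta> k" "\<chi> y = \<zeta> l"
      using g by (simp_all add: \<chi>_pow flip: int_pow_mult)
    then show "\<chi> (x \<otimes> y) = \<chi> x \<otimes>\<^bsub>circle_group\<^esub> \<chi> y"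
      by (simp add: circle_group_def \<zeta>_def cis_mult algebra_simps add_divide_distrib)
  qed (simp add: \<chi>_def \<zeta>_def circle_group_def)
  moreover have "\<chi> g = cis (2 * pi / real (ord g))"
    using \<chi>_pow[of 1] g by (simp add: \<zeta>_def)
  ultimately show thesis ..
qed

text \<open>
  Enlarge the subgroup to a maximal proper subgroup \<open>M\<close>. By maximality \<open>M\<close> together with any
  \<open>g \<notin> M\<close> generates the group, so the quotient by \<open>M\<close> is cyclic and nontrivial, and a cyclic
  group has a character that sends its generator to a primitive root of unity.
  Passing to a maximal subgroup avoids extending characters step by step.
\<close>

lemma (in comm_group) exists_character_trivial_on_subgroup:
  assumes fin: "finite (carrier G)" and H: "subgroup H G" and proper: "H \<noteq> carrier G"
  obtains \<chi> g where "\<chi> \<in> hom G circle_group" "\<And>h. h \<in> H \<Longrightarrow> \<chi> h = 1"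
    "g \<in> carrier G" "\<chi> g \<noteq> 1"
proof -
  let ?S = "{M. subgroup M G \<and> M \<noteq> carrier G}"
  have "?S \<subseteq> Pow (carrier G)"
    by (auto dest: subgroup.subset)
  then have "finite ?S"
    using fin by (meson finite_Pow_iff finite_subset)
  from finite_has_maximal2[OF this, of H] H proper
  obtain M where M: "subgroup M G" "M \<noteq> carrier G" and HM: "H \<subseteq> M"
    and max: "\<And>N. subgroup N G \<Longrightarrow> M \<subseteq> N \<Longrightarrow> N \<noteq> carrier G \<Longrightarrow> M = N"
    by auto
  interpret M: normal M G
    by (rule subgroup_imp_normal) fact
  obtain g where g: "g \<in> carrier G" "g \<notin> M"
    using M M.subset by auto
  let ?Q = "G Mod M"
  interpret Q: group ?Q
    by (rule M.factorgroup_is_group)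
  interpret \<pi>: group_hom G ?Q "\<lambda>x. M #> x"
    by unfold_locales (rule M.r_coset_hom_Mod)
  have \<pi>_M: "M #> x = \<one>\<^bsub>?Q\<^esub> \<longleftrightarrow> x \<in> M" if "x \<in> carrier G" for x
    using that M(1) coset_join1[of M x] coset_join2[of x M] by auto
  have full: "M <#> generate G {g} = carrier G"
  proof (rule ccontr)
    assume ne: "M <#> generate G {g} \<noteq> carrier G"
    have sg: "subgroup (generate G {g}) G"
      using g by (intro generate_is_subgroup) auto
    have "M \<subseteq> M <#> generate G {g}"
      using subgroup.one_closed[OF sg] M.subset by (force simp: set_mult_def)
    then have "M = M <#> generate G {g}"
      using ne by (intro max mult_subgroups M sg) auto
    moreover have "\<one> \<otimes> g \<in> M <#> generate G {g}"
      unfolding set_mult_def using M.one_closed by (blast intro: generate.incl)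
    ultimately show False
      using g by simp
  qed
  have "carrier ?Q \<subseteq> range (\<lambda>k::int. (M #> g) [^]\<^bsub>?Q\<^esub> k)"
  proof
    fix c assume "c \<in> carrier ?Q"
    then obtain x where x: "x \<in> carrier G" "c = M #> x"
      by (auto simp: carrier_FactGroup)
    then have "x \<in> M <#> generate G {g}"
      by (simp only: full)
    then obtain m and k :: int where m: "m \<in> M" and xmk: "x = m \<otimes> g [^] k"
      using g(1) by (auto simp: set_mult_def generate_pow)
    have mc: "m \<in> carrier G"
      using m M.subset by auto
    have "c = (M #> m) \<otimes>\<^bsub>?Q\<^esub> (M #> g [^] k)"
      using mc g by (simp add: x xmk del: mult_FactGroup)
    also have "\<dots> = (M #> g) [^]\<^bsub>?Q\<^esub> k"
      using mc m g \<pi>_M[of m] \<pi>.hom_int_pow[of g k] by (simp del: mult_FactGroup one_FactGroup)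
    finally show "c \<in> range (\<lambda>k::int. (M #> g) [^]\<^bsub>?Q\<^esub> k)"
      by blast
  qed
  moreover have gQ: "M #> g \<in> carrier ?Q"
    using g by simp
  ultimately have gen: "carrier ?Q = range (\<lambda>k::int. (M #> g) [^]\<^bsub>?Q\<^esub> k)"
    by (auto simp del: carrier_FactGroup)
  have "finite (carrier ?Q)"
    using fin by (simp add: carrier_FactGroup)
  then have pos: "Q.ord (M #> g) > 0"
    using gQ Q.ord_ge_1 by fastforce
  have "M #> g \<noteq> \<one>\<^bsub>?Q\<^esub>"
    using \<pi>_M g by blast
  then have ne1: "Q.ord (M #> g) \<noteq> 1"
    using gQ Q.ord_eq_1 by blast
  obtain \<psi> where \<psi>: "\<psi> \<in> hom ?Q circle_group" "\<psi> (M #> g) = cis (2 * pi / real (Q.ord (M #> g)))"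
    using Q.cyclic_group_character[OF gQ gen pos] .
  have "\<psi> \<circ> (\<lambda>x. M #> x) \<in> hom G circle_group"
    by (rule Group.hom_compose[OF M.r_coset_hom_Mod \<psi>(1)])
  moreover have "(\<psi> \<circ> (\<lambda>x. M #> x)) h = 1" if "h \<in> H" for h
  proof -
    interpret T: comm_group circle_group by (rule comm_group_circle_group)
    have "h \<in> M" "h \<in> carrier G"
      using that HM M.subset by auto
    then have "(\<psi> \<circ> (\<lambda>x. M #> x)) h = \<psi> \<one>\<^bsub>?Q\<^esub>"
      using \<pi>_M[of h] by (simp del: one_FactGroup)
    also have "\<dots> = \<one>\<^bsub>circle_group\<^esub>"
      by (rule hom_one[OF \<psi>(1) Q.is_group T.is_group])
    finally show ?thesis
      by (simp add: circle_group_def)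
  qed
  moreover have "(\<psi> \<circ> (\<lambda>x. M #> x)) g \<noteq> 1"
    using cis_root_of_unity_eq_iff[OF pos, of 1 0] ne1 by (simp add: \<psi>(2))
  ultimately show thesis
    using g(1) that by blast
qed

section \<open>Characters of powers of a group\<close>

lemma comm_group_product_group:
  assumes "\<And>i. i \<in> I \<Longrightarrow> comm_group (K i)"
  shows "comm_group (product_group I K)"
proof (rule group.group_comm_groupI)
  show "group (product_group I K)"
    using assms by (intro product_group) (auto dest: comm_group.axioms)
next
  fix x y assume "x \<in> carrier (product_group I K)" "y \<in> carrier (product_group I K)"
  then show "x \<otimes>\<^bsub>product_group I K\<^esub> y = y \<otimes>\<^bsub>product_group I K\<^esub> x"
    using assms by (auto simp: PiE_iff comm_monoid.m_comm comm_group.axioms intro!: restrict_ext)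
qed

definition coordinate_embedding ::
    "'i set \<Rightarrow> ('a, 'm) monoid_scheme \<Rightarrow> 'i \<Rightarrow> 'a \<Rightarrow> 'i \<Rightarrow> 'a" where
  "coordinate_embedding I G i g = (\<lambda>j\<in>I. if j = i then g else \<one>\<^bsub>G\<^esub>)"

lemma coordinate_embedding_closed:
  assumes "group G" "g \<in> carrier G"
  shows "coordinate_embedding I G i g \<in> carrier (product_group I (\<lambda>_. G))"
  using assms by (auto simp: coordinate_embedding_def group.is_monoid)

lemma coordinate_embedding_mult:
  assumes "group G" "g \<in> carrier G" "h \<in> carrier G"
  shows "coordinate_embedding I G i (g \<otimes>\<^bsub>G\<^esub> h) =
    coordinate_embedding I G i g \<otimes>\<^bsub>product_group I (\<lambda>_. G)\<^esub> coordinate_embedding I G i h"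
  using assms by (auto simp: coordinate_embedding_def group.is_monoid intro!: restrict_ext)

text \<open>
  Every \<open>B\<close> is the product of the embeddings of its entries; the induction turns on these
  entries one coordinate at a time.
\<close>

lemma character_product_group_eq_prod:
  assumes G: "group G" and I: "finite I"
    and \<chi>: "\<chi> \<in> hom (product_group I (\<lambda>_. G)) circle_group"
    and B: "B \<in> carrier (product_group I (\<lambda>_. G))"
  shows "\<chi> B = (\<Prod>i\<in>I. \<chi> (coordinate_embedding I G i (B i)))"
proof -
  let ?K = "product_group I (\<lambda>_. G)"
  interpret G: group G by fact
  interpret K: group ?K by (simp add: G)
  interpret T: comm_group circle_group by (rule comm_group_circle_group)
  define B' where "B' J = (\<lambda>j\<in>I. if j \<in> J then B j else \<one>\<^bsub>G\<^esub>)" for J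
  have "\<chi> (B' J) = (\<Prod>i\<in>J. \<chi> (coordinate_embedding I G i (B i)))" if "finite J" "J \<subseteq> I" for J
    using that
  proof (induction J rule: finite_induct)
    case empty
    have "\<chi> \<one>\<^bsub>?K\<^esub> = \<one>\<^bsub>circle_group\<^esub>"
      by (rule hom_one[OF \<chi> K.is_group T.is_group])
    then show ?case
      by (simp add: B'_def circle_group_def restrict_def)
  next
    case (insert i J)
    have "B' (insert i J) = coordinate_embedding I G i (B i) \<otimes>\<^bsub>?K\<^esub> B' J"
      using insert.hyps insert.prems B
      by (auto simp: B'_def coordinate_embedding_def PiE_iff intro!: restrict_ext)
    moreover have "coordinate_embedding I G i (B i) \<in> carrier ?K"
      using insert.prems B by (intro coordinate_embedding_closed G) auto
    moreover have "B' J \<in> carrier ?K"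
      using B by (auto simp: B'_def)
    ultimately have "\<chi> (B' (insert i J)) = \<chi> (coordinate_embedding I G i (B i)) * \<chi> (B' J)"
      using hom_mult[OF \<chi>] by (metis (no_types, lifting) circle_group_def monoid.simps(1))
    then show ?case
      using insert by simp
  qed
  from this[OF I order_refl] show ?thesis
    using B by (simp add: B'_def PiE_iff extensional_restrict cong: restrict_cong)
qed

text \<open>
  A family of characters supported on \<open>J\<close> is the same as a character of \<open>G\<^sup>J\<close>. The proof stays
  inside \<open>G\<^sup>I\<close>: the group \<open>H\<close> is the preimage in \<open>G\<^sup>I\<close> of the restriction of \<open>P\<close> to \<open>J\<close>, and
  a character that is trivial on \<open>H\<close> is trivial on \<open>P\<close> as well as on every coordinate outside
  \<open>J\<close>. The bound on the size of \<open>P\<close> makes \<open>H\<close> proper by counting.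
\<close>

lemma exists_annihilating_character_family:
  assumes G: "comm_group G" "finite (carrier G)" and I: "finite I" and J: "J \<subseteq> I"
    and P: "subgroup P (product_group I (\<lambda>_. G))" and card: "card P < order G ^ card J"
  obtains A where "A \<in> (\<Pi>\<^sub>E i\<in>I. carrier (character_group G))"
    "A \<noteq> (\<lambda>i\<in>I. \<one>\<^bsub>character_group G\<^esub>)"
    "\<And>i. i \<in> I - J \<Longrightarrow> A i = \<one>\<^bsub>character_group G\<^esub>"
    "\<And>B. B \<in> P \<Longrightarrow> (\<Prod>i\<in>I. A i (B i)) = 1"
proof -
  let ?K = "product_group I (\<lambda>_. G)"
  interpret G: comm_group G by fact
  interpret K: comm_group ?K
    by (rule comm_group_product_group) (rule G)
  interpret P: subgroup P ?K by fact
  define H where "H = {B \<in> carrier ?K. \<exists>B'\<in>P. \<forall>i\<in>J. B i = B' i}"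
  have PH: "P \<subseteq> H"
    using P.subset by (auto simp: H_def)
  have finK: "finite (carrier ?K)"
    using G I by (simp add: finite_PiE)
  have H: "subgroup H ?K"
  proof (rule K.subgroupI)
    show "H \<subseteq> carrier ?K"
      by (auto simp: H_def)
    show "H \<noteq> {}"
      using PH P.one_closed by auto
  next
    fix B assume "B \<in> H"
    then obtain B' where B: "B \<in> carrier ?K" and B': "B' \<in> P" "\<forall>i\<in>J. B i = B' i"
      by (auto simp: H_def)
    have "inv\<^bsub>?K\<^esub> B' \<in> P" "B' \<in> carrier ?K"
      using B' P.subset by auto
    moreover have "\<forall>i\<in>J. (inv\<^bsub>?K\<^esub> B) i = (inv\<^bsub>?K\<^esub> B') i"
      using B B' J \<open>B' \<in> carrier ?K\<close> by (auto simp: inv_product_group)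
    ultimately show "inv\<^bsub>?K\<^esub> B \<in> H"
      unfolding H_def using K.inv_closed[OF B] by blast
  next
    fix B1 B2 assume "B1 \<in> H" "B2 \<in> H"
    then obtain B1' B2' where B: "B1 \<in> carrier ?K" "B2 \<in> carrier ?K"
      and B': "B1' \<in> P" "B2' \<in> P" "\<forall>i\<in>J. B1 i = B1' i" "\<forall>i\<in>J. B2 i = B2' i"
      by (auto simp: H_def)
    have "\<forall>i\<in>J. (B1 \<otimes>\<^bsub>?K\<^esub> B2) i = (B1' \<otimes>\<^bsub>?K\<^esub> B2') i"
      using B' J by auto
    with P.m_closed[OF B'(1,2)] show "B1 \<otimes>\<^bsub>?K\<^esub> B2 \<in> H"
      unfolding H_def using K.m_closed[OF B] by blast
  qed
  have "H \<noteq> carrier ?K"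
  proof
    assume eq: "H = carrier ?K"
    have "(\<Pi>\<^sub>E i\<in>J. carrier G) \<subseteq> (\<lambda>B. restrict B J) ` P"
    proof
      fix f assume f: "f \<in> (\<Pi>\<^sub>E i\<in>J. carrier G)"
      define B where "B = (\<lambda>i\<in>I. if i \<in> J then f i else \<one>\<^bsub>G\<^esub>)"
      have "B \<in> H"
        unfolding eq using f by (auto simp: B_def)
      then obtain B' where B': "B' \<in> P" "\<forall>i\<in>J. B i = B' i"
        by (auto simp: H_def)
      have "f = restrict B' J"
      proof
        fix i show "f i = restrict B' J i"
          using B'(2)[rule_format, of i] f J by (cases "i \<in> J") (auto simp: B_def)
      qed
      with B'(1) show "f \<in> (\<lambda>B. restrict B J) ` P"
        by blast
    qed
    moreover have finP: "finite P"
      using finK P.subset finite_subset by blast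
    ultimately have "card (\<Pi>\<^sub>E i\<in>J. carrier G) \<le> card P"
      by (rule surj_card_le[rotated])
    moreover have "card (\<Pi>\<^sub>E i\<in>J. carrier G) = order G ^ card J"
      using finite_subset[OF J I] by (simp add: card_PiE order_def)
    ultimately show False
      using card by simp
  qed
  from K.exists_character_trivial_on_subgroup[OF finK H this]
  obtain \<chi> B0 where \<chi>: "\<chi> \<in> hom ?K circle_group" "\<And>B. B \<in> H \<Longrightarrow> \<chi> B = 1"
    and B0: "B0 \<in> carrier ?K" "\<chi> B0 \<noteq> 1"
    by blast
  define A where "A = (\<lambda>i\<in>I. \<lambda>g\<in>carrier G. \<chi> (coordinate_embedding I G i g))"
  have prod: "(\<Prod>i\<in>I. A i (B i)) = \<chi> B" if "B \<in> carrier ?K" for B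
    using that by (auto simp: A_def character_product_group_eq_prod[OF G.is_group I \<chi>(1) that]
        intro!: prod.cong)
  show thesis
  proof
    show "A \<in> (\<Pi>\<^sub>E i\<in>I. carrier (character_group G))"
    proof (rule PiE_I)
      fix i assume i: "i \<in> I"
      have "A i \<in> hom G circle_group"
      proof (rule homI)
        fix g assume "g \<in> carrier G"
        then show "A i g \<in> carrier circle_group"
          using i hom_in_carrier[OF \<chi>(1) coordinate_embedding_closed[OF G.is_group]]
          by (simp add: A_def)
      next
        fix g h assume "g \<in> carrier G" "h \<in> carrier G"
        then show "A i (g \<otimes>\<^bsub>G\<^esub> h) = A i g \<otimes>\<^bsub>circle_group\<^esub> A i h"
          using i hom_mult[OF \<chi>(1) coordinate_embedding_closed[OF G.is_group]
              coordinate_embedding_closed[OF G.is_group]]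
          by (simp add: A_def coordinate_embedding_mult[OF G.is_group] del: mult_product_group)
      qed
      then show "A i \<in> carrier (character_group G)"
        using i by (simp add: character_group_def A_def)
    qed (simp add: A_def)
    show "A \<noteq> (\<lambda>i\<in>I. \<one>\<^bsub>character_group G\<^esub>)"
    proof
      assume "A = (\<lambda>i\<in>I. \<one>\<^bsub>character_group G\<^esub>)"
      then have "(\<Prod>i\<in>I. A i (B0 i)) = 1"
        using B0(1) by (auto simp: character_group_def circle_group_def intro!: prod.neutral)
      with prod[OF B0(1)] B0(2) show False
        by simp
    qed
    show "A i = \<one>\<^bsub>character_group G\<^esub>" if "i \<in> I - J" for i
    proof -
      have "coordinate_embedding I G i g \<in> H" if g: "g \<in> carrier G" for g
        unfolding H_def mem_Collect_eq
      proof (intro conjI coordinate_embedding_closed[OF G.is_group g] bexI)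
        show "\<forall>j\<in>J. coordinate_embedding I G i g j = \<one>\<^bsub>?K\<^esub> j"
          using \<open>i \<in> I - J\<close> J by (auto simp: coordinate_embedding_def)
      qed (rule P.one_closed)
      then show ?thesis
        using that by (auto simp: A_def character_group_def circle_group_def \<chi>(2) intro!: restrict_ext)
    qed
    show "(\<Prod>i\<in>I. A i (B i)) = 1" if "B \<in> P" for B
    proof -
      have "B \<in> H" "B \<in> carrier ?K"
        using that PH P.subset by blast+
      then show ?thesis
        using prod \<chi>(2) by simp
    qed
  qed
qed

section \<open>A light element of the annihilator\<close>

text \<open>
  The weight bound is that of a matrix with nonzero entries throughout its first \<open>m\<close> columns;
  the factor 2 avoids division on the natural numbers.
\<close>

lemma exists_annihilator_in_first_columns:
  assumes G: "comm_group G" "finite (carrier G)"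
    and P: "subgroup P (matrix_group s n G)" and card: "card P < order G ^ (s * m)" and m: "m \<le> n"
  obtains A where "A \<in> annihilator s n G P" "A \<noteq> \<one>\<^bsub>matrix_group s n (character_group G)\<^esub>"
    "2 * dick_weight s n G A \<le> s * (m * (m + 1))"
proof -
  let ?I = "{1..s} \<times> {1..n}" and ?J = "{1..s} \<times> {1..m}"
  have "card P < order G ^ card ?J" "?J \<subseteq> ?I"
    using card m by auto
  from exists_annihilating_character_family[OF G _ this(2) P[unfolded matrix_group_def] this(1)]
  obtain A where A: "A \<in> (\<Pi>\<^sub>E i\<in>?I. carrier (character_group G))"
      "A \<noteq> (\<lambda>i\<in>?I. \<one>\<^bsub>character_group G\<^esub>)"
      "\<And>i. i \<in> ?I - ?J \<Longrightarrow> A i = \<one>\<^bsub>character_group G\<^esub>"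
      "\<And>B. B \<in> P \<Longrightarrow> (\<Prod>i\<in>?I. A i (B i)) = 1"
    by auto
  have "A \<in> annihilator s n G P"
    using A(1,4) by (simp add: annihilator_def matrix_group_def matrix_pairing_def
        prod.cartesian_product split_def)
  moreover have "A \<noteq> \<one>\<^bsub>matrix_group s n (character_group G)\<^esub>"
    using A(2) by (simp add: matrix_group_def)
  moreover have "2 * dick_weight s n G A \<le> s * (m * (m + 1))"
  proof -
    have "(\<Sum>j=1..n. j * (if A (i, j) = \<one>\<^bsub>character_group G\<^esub> then 0 else 1)) \<le> (\<Sum>j=1..m. j)"
      if "i \<in> {1..s}" for i
    proof -
      have "(\<Sum>j=1..n. j * (if A (i, j) = \<one>\<^bsub>character_group G\<^esub> then 0 else 1)) =
            (\<Sum>j=1..m. j * (if A (i, j) = \<one>\<^bsub>character_group G\<^esub> then 0 else 1))"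
        using that m A(3) by (intro sum.mono_neutral_right) auto
      also have "\<dots> \<le> (\<Sum>j=1..m. j)"
        by (intro sum_mono) auto
      finally show ?thesis .
    qed
    then have "dick_weight s n G A \<le> (\<Sum>i=1..s. \<Sum>j=1..m. j)"
      unfolding dick_weight_def by (intro sum_mono)
    moreover have "2 * (\<Sum>j=1..m. j) = m * (m + 1)"
      by (induction m) auto
    ultimately show ?thesis
      by simp (metis mult.left_commute mult_le_mono2)
  qed
  ultimately show thesis ..
qed

lemma WAFOM_ge_term:
  assumes "group G" "finite (carrier G)"
    and "A \<in> annihilator s n G P" "A \<noteq> \<one>\<^bsub>matrix_group s n (character_group G)\<^esub>"
  shows "WAFOM s n G P \<ge> real (order G) powr - real (dick_weight s n G A)"
  unfolding WAFOM_def
  using assms finite_annihilator[OF assms(1,2)]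
  by (intro member_le_sum[where f = "\<lambda>A. real (order G) powr - real (dick_weight s n G A)"]) auto

text \<open>
  With \<open>c = C - 1/2\<close> the claim is \<open>1 \<le> c x\<^sup>2 - 3/2 x\<close>. Multiplying by \<open>c\<close> and completing the
  square turns it into \<open>C + 1/16 \<le> (c x - 3/4)\<^sup>2\<close>, which is the square of the hypothesis.
\<close>

lemma quadratic_bound_of_threshold:
  fixes C x :: real
  assumes C: "C > 1 / 2" and x: "x \<ge> (sqrt (C + 1 / 16) + 3 / 4) / (C - 1 / 2)"
  shows "(x + 1) * (x + 2) / 2 \<le> C * x\<^sup>2"
proof -
  define c where "c = C - 1 / 2"
  have c: "c > 0"
    using C by (simp add: c_def)
  have "sqrt (C + 1 / 16) \<le> c * x - 3 / 4"
    using x c by (simp add: field_simps flip: c_def)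
  then have "(sqrt (C + 1 / 16))\<^sup>2 \<le> (c * x - 3 / 4)\<^sup>2"
    using C by (intro power_mono) auto
  then have "c + 1 / 2 + 1 / 16 \<le> (c * x - 3 / 4)\<^sup>2"
    using C by (simp add: c_def)
  then have "c * 1 \<le> c * (c * x\<^sup>2 - 3 / 2 * x)"
    by (simp add: power2_eq_square algebra_simps)
  then have "1 \<le> c * x\<^sup>2 - 3 / 2 * x"
    using c by (simp only: mult_le_cancel_left_pos)
  then show ?thesis
    by (simp add: c_def power2_eq_square algebra_simps)
qed

theorem theorem5p17:
  fixes G :: "('a, 'm) monoid_scheme"
    and P :: "(nat \<times> nat \<Rightarrow> 'a) set"
    and s n d b :: nat
    and C :: real
  assumes "s > 0" and "n > 0" and "d > 0"
    and "comm_group G" and "finite (carrier G)" and "order G = b" and "b \<ge> 2"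
    and "subgroup P (matrix_group s n G)" and "P \<subset> carrier (matrix_group s n G)"
    and "card P \<le> b ^ d"
    and "C > 1 / 2"
    and "real d / real s \<ge> (sqrt (C + 1 / 16) + 3 / 4) / (C - 1 / 2)"
  shows "WAFOM s n G P \<ge> real b powr - (C * (real d)\<^sup>2 / real s)"
proof -
  interpret G: comm_group G by fact
  define m where "m = min n (d div s + 1)"
  have "card P < order G ^ (s * m)"
  proof (cases "n \<le> d div s + 1")
    case True
    have "finite (carrier (matrix_group s n G))"
      using assms(5) by (simp add: matrix_group_def finite_PiE)
    then have "card P < card (carrier (matrix_group s n G))"
      using assms(9) by (rule psubset_card_mono)
    also have "\<dots> = order G ^ (s * m)"
      using True by (simp add: matrix_group_def card_PiE order_def m_def)
    finally show ?thesis .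
  next
    case False
    have "d < s * (d div s + 1)"
      using \<open>s > 0\<close> by (metis Suc_eq_plus1 dividend_less_times_div mult_Suc_right add.commute)
    then have "b ^ d < b ^ (s * m)"
      using \<open>b \<ge> 2\<close> False by (intro power_strict_increasing) (auto simp: m_def)
    then show ?thesis
      using assms(6,10) by simp
  qed
  moreover have "m \<le> n"
    by (simp add: m_def)
  ultimately obtain A where A: "A \<in> annihilator s n G P"
      "A \<noteq> \<one>\<^bsub>matrix_group s n (character_group G)\<^esub>"
      "2 * dick_weight s n G A \<le> s * (m * (m + 1))"
    using exists_annihilator_in_first_columns[OF assms(4,5,8)] by blast
  define x where "x = real d / real s"
  have "real m \<le> x + 1"
  proof -
    have "real m \<le> real (d div s) + 1"
      by (simp add: m_def)
    then show ?thesis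
      using of_nat_div_le_of_nat[of d s, where 'a = real] by (simp add: x_def)
  qed
  then have "real m * (real m + 1) \<le> (x + 1) * (x + 2)"
    by (intro mult_mono) (auto simp: x_def)
  also have "\<dots> \<le> 2 * (C * x\<^sup>2)"
    using quadratic_bound_of_threshold[of C x] assms(11,12) by (simp add: x_def)
  finally have "real s * (real m * (real m + 1)) \<le> real s * (2 * (C * x\<^sup>2))"
    by (intro mult_left_mono) auto
  moreover have "2 * real (dick_weight s n G A) \<le> real s * (real m * (real m + 1))"
    using of_nat_mono[OF A(3), where 'a = real] by (simp add: algebra_simps)
  ultimately have "real (dick_weight s n G A) \<le> real s * (C * x\<^sup>2)"
    by linarith
  also have "\<dots> = C * (real d)\<^sup>2 / real s"
    using \<open>s > 0\<close> by (simp add: x_def power2_eq_square)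
  finally have "real b powr - (C * (real d)\<^sup>2 / real s) \<le> real b powr - real (dick_weight s n G A)"
    using \<open>b \<ge> 2\<close> by (intro powr_mono) auto
  also have "\<dots> \<le> WAFOM s n G P"
    using WAFOM_ge_term[OF G.is_group assms(5) A(1,2)] assms(6) by simp
  finally show ?thesis .
qed

end
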